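(* Let $h_{PSF}=[h_i]_{i=-q,\ldots,q}$ be a generic (not necessarily symmetric) one-dimensional PSF and let $A=A(h)\in\mathbb{R}^{n\times n}$ be the Anti-Reflective matrix generated by $h_{PSF}$. Then the optimal preconditioner of $A$ in the algebra $\mathcal{AR}_n^{1D}$, i.e. $$P^*=\underset{P\in\mathcal{AR}_n^{1D}}{\arg\min}\ \|A-P\|_{\mathcal F}^2,$$ is the Anti-Reflective matrix $A(s)$ generated by the symmetrized PSF $s_{PSF}=[s_q,\ldots,s_1,s_0,s_1,\ldots,s_q]$, where $$s_i=\frac{h_{-i}+h_i}{2},\qquad i=0,\ldots,q.$$
   Context: A one-dimensional mask is a real vector $[h_i]_{i=-q,\ldots,q}$; it is called a PSF (point spread function) if $h_i\ge 0$ for all $i$ and $\sum_{i=-q}^{q}h_i=1$. Standing assumption on the support: $q\le n-3$ (i.e. $h_i=0$ if $|i|\ge n-2$), where $n\ge 3$ is the matrix size. Anti-Reflective matrix: given a mask $h=[h_i]_{i=-q,\ldots,q}$ with $q\le n-3$, $A(h)\in\mathbb{R}^{n\times n}$ is the matrix of the linear map $f=(f_1,\ldots,f_n)\mapsto g=(g_1,\ldots,g_n)$ given by $$g_i=\sum_{s=-q}^{q}h_s f_{i-s},\qquad i=1,\ldots,n,$$ where the values of $f$ with indices outside $\{1,\ldots,n\}$ are defined by the Anti-Reflective boundary conditions $$f_{1-i}=2f_1-f_{1+i},\qquad f_{n+i}=2f_n-f_{n-i},\qquad i=1,\ldots,q.$$ A mask $s$ is strongly symmetric if $s_{-i}=s_i$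 for all $i$. The algebra $\mathcal{AR}_n^{1D}$ is the set of all Anti-Reflective matrices $A(s)\in\mathbb{R}^{n\times n}$ generated by strongly symmetric real masks $s=[s_i]_{i=-q',\ldots,q'}$ with $q'\le n-3$ (no sign or normalization condition is imposed on these masks). $\|\cdot\|_{\mathcal F}$ is the Frobenius norm, $\|A\|_{\mathcal F}=\sqrt{\sum_{i,j}|a_{i,j}|^2}$. *)

theory Defs
  imports "Jordan_Normal_Form.Matrix"
begin

(* A mask [h_i], i = -q..q, is a function h :: int => real together with its half-width q;
   the values of h outside {-q..q} are never used. *)

definition psf :: "nat \<Rightarrow> (int \<Rightarrow> real) \<Rightarrow> bool" where
  "psf q h \<longleftrightarrow> (\<forall>i\<in>{- int q..int q}. 0 \<le> h i) \<and> (\<Sum>i = - int q..int q. h i) = 1"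

definition strongly_symmetric :: "nat \<Rightarrow> (int \<Rightarrow> real) \<Rightarrow> bool" where
  "strongly_symmetric q s \<longleftrightarrow> (\<forall>i\<in>{- int q..int q}. s (- i) = s i)"

definition symmetrized :: "(int \<Rightarrow> real) \<Rightarrow> int \<Rightarrow> real" where
  "symmetrized h i = (h (- \<bar>i\<bar>) + h \<bar>i\<bar>) / 2"

(* The mathematical indices run over 1..n, those of type vec over 0..<n: f_k is f $ (k - 1).
   The first two branches are f_{1-i} = 2 f_1 - f_{1+i} at j = 1 - i and
   f_{n+i} = 2 f_n - f_{n-i} at j = n + i. *)
definition ar_extend :: "real vec \<Rightarrow> int \<Rightarrow> real" where
  "ar_extend f j =
    (let n = int (dim_vec f); F = (\<lambda>k::int. f $ nat (k - 1)) in
     if j < 1 then 2 * F 1 - F (2 - j)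
     else if j > n then 2 * F n - F (2 * n - j)
     else F j)"

definition ar_blur :: "nat \<Rightarrow> (int \<Rightarrow> real) \<Rightarrow> real vec \<Rightarrow> real vec" where
  "ar_blur q h f =
    vec (dim_vec f) (\<lambda>i. \<Sum>s = - int q..int q. h s * ar_extend f (int i + 1 - s))"

definition ar_matrix :: "nat \<Rightarrow> nat \<Rightarrow> (int \<Rightarrow> real) \<Rightarrow> real mat" where
  "ar_matrix n q h = mat n n (\<lambda>(i, j). ar_blur q h (unit_vec n j) $ i)"

definition ar_algebra :: "nat \<Rightarrow> real mat set" where
  "ar_algebra n = {ar_matrix n q s | q s. q + 3 \<le> n \<and> strongly_symmetric q s}"

definition frobenius_norm :: "real mat \<Rightarrow> real" where
  "frobenius_norm A = sqrt (\<Sum>i<dim_row A. \<Sum>j<dim_col A. \<bar>A $$ (i, j)\<bar>\<^sup>2)"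

lemma symmetrized_strongly_symmetric: "strongly_symmetric q (symmetrized h)"
  by (simp add: strongly_symmetric_def symmetrized_def)

lemma psf_symmetrized:
  assumes "psf q h"
  shows "psf q (symmetrized h)"
proof -
  have sym: "symmetrized h i = (h (- i) + h i) / 2" for i
    by (simp add: symmetrized_def abs_if)
  have "(\<Sum>i = - int q..int q. h (- i)) = (\<Sum>i = - int q..int q. h i)"
    by (rule sum.reindex_bij_witness[of _ uminus uminus]) auto
  with assms show ?thesis
    unfolding psf_def sym
    by (auto simp: sum.distrib simp flip: sum_divide_distrib)
qed

lemma vec_unit_expansion:
  fixes f :: "real vec"
  assumes "f \<in> carrier_vec n" "k < n"
  shows "f $ k = (\<Sum>j = 0..<n. unit_vec n j $ k * f $ j)"
proof -
  have "(\<Sum>j = 0..<n. unit_vec n j $ k * f $ j) = (\<Sum>j = 0..<n. if j = k then f $ j else 0)"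
    using assms by (intro sum.cong) auto
  with assms show ?thesis by simp
qed

lemma ar_extend_expansion:
  assumes f: "f \<in> carrier_vec n" and n: "0 < n"
    and j: "- int n < j - 1" "j < 2 * int n"
  shows "ar_extend f j = (\<Sum>k = 0..<n. ar_extend (unit_vec n k) j * f $ k)"
proof -
  note e = vec_unit_expansion[OF f]
  have d: "dim_vec f = n" using f by simp
  consider "j < 1" | "1 \<le> j" "j \<le> int n" | "j > int n" by linarith
  then show ?thesis
  proof cases
    case 1
    then have "nat (2 - j - 1) < n" "nat (1 - 1) < n" using j n by auto
    from this[THEN e] 1 show ?thesis
      by (simp add: ar_extend_def d Let_def sum_subtractf sum_distrib_left algebra_simps
          del: index_unit_vec(1,2))
  next
    case 2
    then have "nat (j - 1) < n" by auto
    from e[OF this] 2 show ?thesis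
      by (simp add: ar_extend_def d Let_def del: index_unit_vec(1,2))
  next
    case 3
    then have "nat (2 * int n - j - 1) < n" "nat (int n - 1) < n" using j n by auto
    from this[THEN e] 3 n show ?thesis
      by (simp add: ar_extend_def d Let_def sum_subtractf sum_distrib_left algebra_simps
          del: index_unit_vec(1,2))
  qed
qed

lemma ar_matrix_mult_vec:
  assumes f: "f \<in> carrier_vec n" and q: "q + 3 \<le> n"
  shows "ar_matrix n q h *\<^sub>v f = ar_blur q h f"
proof (rule eq_vecI)
  show "dim_vec (ar_matrix n q h *\<^sub>v f) = dim_vec (ar_blur q h f)"
    using f by (simp add: ar_matrix_def ar_blur_def)
  fix i assume "i < dim_vec (ar_blur q h f)"
  then have i: "i < n" using f by (simp add: ar_blur_def)
  have "(ar_matrix n q h *\<^sub>v f) $ i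
      = (\<Sum>k = 0..<n. (\<Sum>s = - int q..int q. h s * ar_extend (unit_vec n k) (int i + 1 - s)) * f $ k)"
    using i f by (simp add: ar_matrix_def ar_blur_def scalar_prod_def)
  also have "\<dots> = (\<Sum>s = - int q..int q. \<Sum>k = 0..<n. h s * ar_extend (unit_vec n k) (int i + 1 - s) * f $ k)"
    by (simp only: sum_distrib_right) (rule sum.swap)
  also have "\<dots> = (\<Sum>s = - int q..int q. h s * ar_extend f (int i + 1 - s))"
  proof (rule sum.cong[OF refl])
    fix s assume "s \<in> {- int q..int q}"
    then have "ar_extend f (int i + 1 - s)
        = (\<Sum>k = 0..<n. ar_extend (unit_vec n k) (int i + 1 - s) * f $ k)"
      using i q by (intro ar_extend_expansion[OF f]) auto
    then show "(\<Sum>k = 0..<n. h s * ar_extend (unit_vec n k) (int i + 1 - s) * f $ k)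
        = h s * ar_extend f (int i + 1 - s)"
      by (simp add: sum_distrib_left mult.assoc)
  qed
  finally show "(ar_matrix n q h *\<^sub>v f) $ i = ar_blur q h f $ i"
    using i f by (simp add: ar_blur_def)
qed

end

theory Submission
  imports Defs
begin

text \<open>
  Reversing the order of the rows and of the columns turns \<open>A(h)\<close> into the matrix of the
  reflected mask. Hence matrices in the algebra are fixed by this involution, whereas the
  difference between \<open>A(h)\<close> and the matrix of the symmetrized mask changes sign. Fixed and
  sign-changing matrices are orthogonal for the Frobenius inner product, so the claim is
  Pythagoras' theorem.
\<close>

text \<open>With J the exchange matrix this is J X J = X. Indices are 0-based, so the mirror image
  of \<open>i\<close> is \<open>n - 1 - i\<close>.\<close>

definition centrosymmetric :: "nat \<Rightarrow> real mat \<Rightarrow> bool" where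
  "centrosymmetric n X \<longleftrightarrow> (\<forall>i<n. \<forall>j<n. X $$ (n - 1 - i, n - 1 - j) = X $$ (i, j))"

definition skew_centrosymmetric :: "nat \<Rightarrow> real mat \<Rightarrow> bool" where
  "skew_centrosymmetric n X \<longleftrightarrow> (\<forall>i<n. \<forall>j<n. X $$ (n - 1 - i, n - 1 - j) = - X $$ (i, j))"

lemma sum_flip:
  fixes f :: "nat \<Rightarrow> 'a::comm_monoid_add"
  shows "(\<Sum>i<n. f (n - 1 - i)) = (\<Sum>i<n. f i)"
  by (rule sum.reindex_bij_witness[of _ "\<lambda>i. n - 1 - i" "\<lambda>i. n - 1 - i"]) auto

text \<open>Flipping both indices only permutes the products of entries but changes the sign of
  each, so the sum equals its own negative.\<close>

lemma skew_centrosymmetric_orthogonal: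
  assumes X: "skew_centrosymmetric n X" and Y: "centrosymmetric n Y"
  shows "(\<Sum>i<n. \<Sum>j<n. X $$ (i, j) * Y $$ (i, j)) = 0"
proof -
  let ?g = "\<lambda>i j. X $$ (i, j) * Y $$ (i, j)"
  have "(\<Sum>i<n. \<Sum>j<n. ?g i j) = (\<Sum>i<n. \<Sum>j<n. ?g (n - 1 - i) (n - 1 - j))"
    by (simp only: sum_flip[of "\<lambda>j. ?g _ j"] sum_flip[of "\<lambda>i. \<Sum>j<n. ?g i j"])
  also have "\<dots> = (\<Sum>i<n. \<Sum>j<n. - ?g i j)"
    using X Y by (intro sum.cong refl)
      (simp add: skew_centrosymmetric_def centrosymmetric_def del: diff_diff_left)
  finally show ?thesis by (simp add: sum_negf)
qed

lemma frobenius_norm_square: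
  assumes "A \<in> carrier_mat n m"
  shows "(frobenius_norm A)\<^sup>2 = (\<Sum>i<n. \<Sum>j<m. (A $$ (i, j))\<^sup>2)"
  using assms by (simp add: frobenius_norm_def sum_nonneg)

lemma frobenius_norm_eq_0:
  assumes A: "A \<in> carrier_mat n m" and 0: "frobenius_norm A = 0"
  shows "A = 0\<^sub>m n m"
proof (rule eq_matI)
  fix i j assume "i < dim_row (0\<^sub>m n m :: real mat)" "j < dim_col (0\<^sub>m n m :: real mat)"
  then show "A $$ (i, j) = 0\<^sub>m n m $$ (i, j)"
    using 0 frobenius_norm_square[OF A] by (simp add: sum_nonneg_eq_0_iff sum_nonneg)
qed (use A in auto)

text \<open>The cross term of the expanded square is twice the inner product of \<open>X\<close> and
  \<open>Y\<close>, which vanishes by orthogonality.\<close>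

lemma frobenius_pythagoras:
  assumes X: "X \<in> carrier_mat n n" "skew_centrosymmetric n X"
    and Y: "Y \<in> carrier_mat n n" "centrosymmetric n Y"
  shows "(frobenius_norm (X + Y))\<^sup>2 = (frobenius_norm X)\<^sup>2 + (frobenius_norm Y)\<^sup>2"
proof -
  have "(frobenius_norm (X + Y))\<^sup>2 = (\<Sum>i<n. \<Sum>j<n. (X $$ (i, j))\<^sup>2 + (Y $$ (i, j))\<^sup>2
      + 2 * (X $$ (i, j) * Y $$ (i, j)))"
    using X Y by (simp add: frobenius_norm_square[of _ n n] power2_sum mult.assoc)
  also have "\<dots> = (frobenius_norm X)\<^sup>2 + (frobenius_norm Y)\<^sup>2
      + 2 * (\<Sum>i<n. \<Sum>j<n. X $$ (i, j) * Y $$ (i, j))"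
    using X Y by (simp add: frobenius_norm_square[of _ n n] sum.distrib sum_distrib_left)
  finally show ?thesis using skew_centrosymmetric_orthogonal[OF X(2) Y(2)] by simp
qed

lemma ar_matrix_carrier: "ar_matrix n q h \<in> carrier_mat n n"
  by (simp add: ar_matrix_def)

lemma ar_matrix_index:
  assumes "i < n" "j < n"
  shows "ar_matrix n q h $$ (i, j)
    = (\<Sum>s = - int q..int q. h s * ar_extend (unit_vec n j) (int i + 1 - s))"
  using assms by (simp add: ar_matrix_def ar_blur_def)

text \<open>The boundary conditions at the two ends are mirror images of each other. The position
  \<open>m\<close> is 1-based, so its mirror image is \<open>int n + 1 - m\<close>, while the
  0-based \<open>j\<close> goes to \<open>n - 1 - j\<close>. The bounds on \<open>m\<close> keep the
  reflected indices \<open>2 - m\<close> and \<open>2 * int n - m\<close> inside 1..n whenever they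
  are used.\<close>

lemma ar_extend_flip:
  assumes j: "j < n" and m: "- int n < m - 1" "m < 2 * int n"
  shows "ar_extend (unit_vec n (n - 1 - j)) m = ar_extend (unit_vec n j) (int n + 1 - m)"
proof -
  have flip: "unit_vec n (n - 1 - j) $ nat (k - 1) = (unit_vec n j $ nat (int n - k) :: real)"
    if "1 \<le> k" "k \<le> int n" for k
  proof -
    have "nat (k - 1) = n - 1 - j \<longleftrightarrow> nat (int n - k) = j" using that j by linarith
    then show ?thesis using that j by simp
  qed
  have n: "1 \<le> int n" using j by simp
  consider "m < 1" | "1 \<le> m" "m \<le> int n" | "m > int n" by linarith
  then show ?thesis
  proof cases
    \<comment> \<open>The mirror image of \<open>m\<close> lies beyond \<open>n\<close>, so the
      right-hand side uses the other boundary branch. The instances of \<open>flip\<close> match the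
      end value and the reflected value; the third case is dual.\<close>
    case 1
    with m n flip[of 1] flip[of "2 - m"] show ?thesis
      by (simp add: ar_extend_def Let_def algebra_simps del: index_unit_vec(1,2))
  next
    case 2
    with flip[of m] show ?thesis
      by (simp add: ar_extend_def Let_def algebra_simps del: index_unit_vec(1,2))
  next
    case 3
    with m n flip[of "int n"] flip[of "2 * int n - m"] show ?thesis
      by (simp add: ar_extend_def Let_def algebra_simps del: index_unit_vec(1,2))
  qed
qed

text \<open>Seen in the mirror, a shift by \<open>s\<close> becomes a shift by \<open>- s\<close>,
  so the convolution runs through the mask backwards.\<close>

lemma ar_matrix_flip:
  assumes q: "q + 3 \<le> n" and i: "i < n" and j: "j < n"
  shows "ar_matrix n q h $$ (n - 1 - i, n - 1 - j) = ar_matrix n q (\<lambda>s. h (- s)) $$ (i, j)"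
proof -
  have "ar_matrix n q h $$ (n - 1 - i, n - 1 - j) = (\<Sum>s = - int q..int q.
      h s * ar_extend (unit_vec n (n - 1 - j)) (int (n - 1 - i) + 1 - s))"
    using i j by (intro ar_matrix_index) auto
  also have "\<dots> = (\<Sum>s = - int q..int q. h s * ar_extend (unit_vec n j) (int i + 1 + s))"
  proof (intro sum.cong refl)
    fix s assume "s \<in> {- int q..int q}"
    then have "ar_extend (unit_vec n (n - 1 - j)) (int (n - 1 - i) + 1 - s)
        = ar_extend (unit_vec n j) (int n + 1 - (int (n - 1 - i) + 1 - s))"
      \<comment> \<open>Since \<bar>s\<bar> \<le> q \<le> n - 3, the position lies between 1 - q and
        n + q, within the range where the extension is mirrored.\<close>
      using q i by (intro ar_extend_flip[OF j]) auto
    also have "int n + 1 - (int (n - 1 - i) + 1 - s) = int i + 1 + s" using i by simp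
    finally show "h s * ar_extend (unit_vec n (n - 1 - j)) (int (n - 1 - i) + 1 - s)
        = h s * ar_extend (unit_vec n j) (int i + 1 + s)" by simp
  qed
  also have "\<dots> = (\<Sum>s = - int q..int q. h (- s) * ar_extend (unit_vec n j) (int i + 1 - s))"
    by (rule sum.reindex_bij_witness[of _ uminus uminus]) auto
  finally show ?thesis using i j by (simp add: ar_matrix_index)
qed

lemma ar_algebra_carrier: "P \<in> ar_algebra n \<Longrightarrow> P \<in> carrier_mat n n"
  by (auto simp: ar_algebra_def ar_matrix_carrier)

lemma ar_algebra_centrosymmetric:
  assumes "P \<in> ar_algebra n"
  shows "centrosymmetric n P"
proof -
  from assms obtain q s where P: "P = ar_matrix n q s" and q: "q + 3 \<le> n"
    and s: "strongly_symmetric q s"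
    by (auto simp: ar_algebra_def)
  \<comment> \<open>Strong symmetry constrains \<open>s\<close> only on -q..q, so the reflected mask
    may differ from \<open>s\<close> as a function; the entries agree because their sums stay in
    that range.\<close>
  have "ar_matrix n q (\<lambda>k. s (- k)) $$ (i, j) = ar_matrix n q s $$ (i, j)"
    if "i < n" "j < n" for i j
    using that s by (simp add: ar_matrix_index strongly_symmetric_def)
  then show ?thesis
    by (simp add: centrosymmetric_def P ar_matrix_flip[OF q] del: One_nat_def diff_diff_left)
qed

lemma ar_matrix_symmetrized_index:
  assumes "i < n" "j < n"
  shows "ar_matrix n q (symmetrized h) $$ (i, j)
    = (ar_matrix n q h $$ (i, j) + ar_matrix n q (\<lambda>s. h (- s)) $$ (i, j)) / 2"
proof -
  \<comment> \<open>The absolute values disappear because the average is unchanged when the sign of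
    \<open>s\<close> changes.\<close>
  have sym: "symmetrized h s = (h s + h (- s)) / 2" for s
    by (simp add: symmetrized_def abs_if)
  show ?thesis
    using assms
    by (simp add: ar_matrix_index sym distrib_right add_divide_distrib sum.distrib
        sum_divide_distrib)
qed

text \<open>Write A' for the flip of A. The symmetrized mask gives S = (A + A')/2, the
  centrosymmetric part of A. The flip fixes S, so it sends A - S to A' - S = -(A - S).\<close>

lemma ar_matrix_minus_symmetrized_skew:
  assumes q: "q + 3 \<le> n"
  shows "skew_centrosymmetric n (ar_matrix n q h - ar_matrix n q (symmetrized h))"
proof -
  have S: "ar_matrix n q (symmetrized h) \<in> ar_algebra n"
    using q symmetrized_strongly_symmetric by (auto simp: ar_algebra_def)
  show ?thesis
    unfolding skew_centrosymmetric_def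
  proof (intro allI impI)
    fix i j assume ij: "i < n" "j < n"
    have "ar_matrix n q (symmetrized h) $$ (n - 1 - i, n - 1 - j)
        = ar_matrix n q (symmetrized h) $$ (i, j)"
      using ar_algebra_centrosymmetric[OF S] ij unfolding centrosymmetric_def by blast
    with ij ar_matrix_flip[OF q ij, of h] ar_matrix_symmetrized_index[OF ij, of q h]
    show "(ar_matrix n q h - ar_matrix n q (symmetrized h)) $$ (n - 1 - i, n - 1 - j)
        = - (ar_matrix n q h - ar_matrix n q (symmetrized h)) $$ (i, j)"
      using ar_matrix_carrier[of n q h] ar_matrix_carrier[of n q "symmetrized h"]
      by (simp add: field_simps del: diff_diff_left)
  qed
qed

theorem theorem3:
  fixes n q :: nat and h :: "int \<Rightarrow> real" and P :: "real mat"
  assumes "3 \<le> n" and "q + 3 \<le> n" and "psf q h"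
  shows "is_arg_min (\<lambda>P. (frobenius_norm (ar_matrix n q h - P))\<^sup>2) (\<lambda>P. P \<in> ar_algebra n) P
    \<longleftrightarrow> P = ar_matrix n q (symmetrized h)"
proof -
  let ?A = "ar_matrix n q h" and ?S = "ar_matrix n q (symmetrized h)"
  have S: "?S \<in> ar_algebra n"
    using assms symmetrized_strongly_symmetric by (auto simp: ar_algebra_def)
  note carrier = ar_matrix_carrier[of n q h] ar_algebra_carrier[OF S]
  \<comment> \<open>Only the last summand depends on \<open>Q\<close>, and it vanishes exactly for
    \<open>Q = ?S\<close>; this gives both minimality and uniqueness.\<close>
  have pythagoras: "(frobenius_norm (?A - Q))\<^sup>2
      = (frobenius_norm (?A - ?S))\<^sup>2 + (frobenius_norm (?S - Q))\<^sup>2"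
    if Q: "Q \<in> ar_algebra n" for Q
  proof -
    have split: "?A - Q = (?A - ?S) + (?S - Q)"
      using ar_algebra_carrier[OF Q] carrier by (intro eq_matI) auto
    show ?thesis
      unfolding split
    proof (rule frobenius_pythagoras)
      show "?A - ?S \<in> carrier_mat n n" by (rule minus_carrier_mat[OF carrier(2)])
      show "?S - Q \<in> carrier_mat n n" by (rule minus_carrier_mat[OF ar_algebra_carrier[OF Q]])
      show "skew_centrosymmetric n (?A - ?S)"
        by (rule ar_matrix_minus_symmetrized_skew[OF assms(2)])
      show "centrosymmetric n (?S - Q)"
        using ar_algebra_centrosymmetric[OF S] ar_algebra_centrosymmetric[OF Q]
          ar_algebra_carrier[OF Q] carrier
        by (simp add: centrosymmetric_def)
    qed
  qed
  show ?thesis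
  proof
    have "(frobenius_norm (?A - ?S))\<^sup>2 \<le> (frobenius_norm (?A - Q))\<^sup>2"
      if "Q \<in> ar_algebra n" for Q
      unfolding pythagoras[OF that] by simp
    moreover assume "P = ?S"
    ultimately show "is_arg_min (\<lambda>P. (frobenius_norm (?A - P))\<^sup>2) (\<lambda>P. P \<in> ar_algebra n) P"
      using S by (simp add: is_arg_min_linorder)
  next
    assume min: "is_arg_min (\<lambda>P. (frobenius_norm (?A - P))\<^sup>2) (\<lambda>P. P \<in> ar_algebra n) P"
    then have P: "P \<in> ar_algebra n"
      and "(frobenius_norm (?A - P))\<^sup>2 \<le> (frobenius_norm (?A - ?S))\<^sup>2"
      using S by (auto simp: is_arg_min_linorder)
    \<comment> \<open>Minimality bounds the whole sum by its first summand, which forces the second,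
      a square, to be zero.\<close>
    with pythagoras[OF P] have "frobenius_norm (?S - P) = 0" by simp
    then have 0: "?S - P = 0\<^sub>m n n"
      using ar_algebra_carrier[OF P] carrier by (intro frobenius_norm_eq_0) auto
    have "P = ?S - (?S - P)"
      using ar_algebra_carrier[OF P] carrier by (intro eq_matI) auto
    then show "P = ?S" unfolding 0 using carrier(2) by (intro eq_matI) auto
  qed
qed

end
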